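(* Let $\mathcal{A}$ be a finite alphabet with $\mathrm{Card}(\mathcal{A})=q\ge 2$, and let $k\ge 1$ and $N$ be integers with $q^k+k\le N\le q^{k+1}+k$. Then $M(N)$, the number of words $w\in\mathcal{A}^N$ with $C(w)=K(N)$, is equal to the number of different (directed) paths of length $N-k-1$ in the de Bruijn graph $B(q,k+1)$.
   Context: $\mathcal{A}^n$ denotes the set of words of length $n$ over $\mathcal{A}$, i.e. finite sequences $w=w_1w_2\ldots w_n$ of letters of $\mathcal{A}$. A word $u$ is a factor (or subword) of $w$ if there exist (possibly empty) words $x,y$ over $\mathcal{A}$ with $w=xuy$ (so factors are contiguous). $F_n(w)$ is the set of all factors of $w$ of length $n$. The subword complexity of $w$ is $f_w(n)=\mathrm{Card}(F_n(w))$ for $1\le n\le |w|$ (and $f_w(n)=0$ for $n>|w|$). The maximal complexity of $w$ is $C(w)=\max\{f_w(n) : n\ge 1\}$. The global maximal complexity in $\mathcal{A}^N$ is $K(N)=\max\{C(w) : w\in\mathcal{A}^N\}$, and $M(N)=\mathrm{Card}(\{w\in\mathcal{A}^N : C(w)=K(N)\})$. The de Bruijn graph $B(q,m)$ over $\mathcal{A}$ is the directed graph with vertex set $\mathcal{A}^m$ and arc set $\mathcal{A}^{m+1}$: there is an arc from $x_1x_2\ldots x_m$ to $y_1y_2\ldots y_m$ exactly when $x_2x_3\ldots x_m=y_1y_2\ldots y_{m-1}$, and this arc is denoted $x_1x_2\ldots x_my_m$ (loops are allowed). A path is a directed walk with pairwise distinct vertices; its length is its number of arcs. *)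

theory Defs
  imports "HOL-Library.Sublist" "Graph_Theory.Arc_Walk"
begin

definition words :: "'a set \<Rightarrow> nat \<Rightarrow> 'a list set" where
  "words A n = {w. set w \<subseteq> A \<and> length w = n}"

definition factors :: "nat \<Rightarrow> 'a list \<Rightarrow> 'a list set" where
  "factors n w = {u. length u = n \<and> sublist u w}"

definition subword_complexity :: "'a list \<Rightarrow> nat \<Rightarrow> nat" where
  "subword_complexity w n = card (factors n w)"

lemma finite_factors: "finite (factors n w)"
  by (rule finite_subset[of _ "set (sublists w)"]) (auto simp: factors_def)

lemma subword_complexity_eq_0: "n > length w \<Longrightarrow> subword_complexity w n = 0"
proof -
  assume "n > length w"
  then have "factors n w = {}"
    by (auto simp: factors_def dest: sublist_length_le)
  then show ?thesis
    by (simp add: subword_complexity_def)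
qed

definition max_complexity :: "'a list \<Rightarrow> nat" where
  "max_complexity w = Max (subword_complexity w ` {1..})"

text \<open>The index set is infinite, but the set of values is finite, so the maximum is genuine.\<close>

lemma finite_subword_complexity_values: "finite (subword_complexity w ` {1..})"
proof (rule finite_subset)
  show "subword_complexity w ` {1..} \<subseteq> insert 0 (subword_complexity w ` {..length w})"
  proof (rule image_subsetI)
    fix n
    show "subword_complexity w n \<in> insert 0 (subword_complexity w ` {..length w})"
      using subword_complexity_eq_0[of w n] by (cases "n \<le> length w") auto
  qed
qed simp

definition global_max_complexity :: "'a set \<Rightarrow> nat \<Rightarrow> nat" where
  "global_max_complexity A N = Max (max_complexity ` words A N)"

definition num_max_words :: "'a set \<Rightarrow> nat \<Rightarrow> nat" where
  "num_max_words A N =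
     card {w \<in> words A N. max_complexity w = global_max_complexity A N}"

definition de_bruijn :: "'a set \<Rightarrow> nat \<Rightarrow> ('a list, 'a list) pre_digraph" where
  "de_bruijn A m =
     \<lparr>verts = words A m, arcs = words A (m + 1), tail = butlast, head = tl\<rparr>"

lemma wf_digraph_de_bruijn: "wf_digraph (de_bruijn A m)"
  by unfold_locales
    (auto simp: de_bruijn_def words_def dest: in_set_butlastD list.set_sel(2)[rotated])

lemma arcs_ends_de_bruijn:
  assumes "m \<ge> 1"
  shows "(x, y) \<in> arcs_ends (de_bruijn A m) \<longleftrightarrow>
    x \<in> words A m \<and> y \<in> words A m \<and> tl x = butlast y"
proof
  assume "(x, y) \<in> arcs_ends (de_bruijn A m)"
  then obtain e where e: "e \<in> words A (m + 1)" "x = butlast e" "y = tl e"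
    by (auto simp: arcs_ends_conv de_bruijn_def)
  moreover have "butlast e \<in> words A m" "tl e \<in> words A m"
    using e(1) by (auto simp: words_def dest: in_set_butlastD list.set_sel(2)[rotated])
  ultimately show "x \<in> words A m \<and> y \<in> words A m \<and> tl x = butlast y"
    by (simp add: butlast_tl)
next
  assume asm: "x \<in> words A m \<and> y \<in> words A m \<and> tl x = butlast y"
  then have ne: "x \<noteq> []" "y \<noteq> []"
    using assms by (auto simp: words_def)
  let ?e = "x @ [last y]"
  have "tl ?e = y"
    using asm ne by simp
  moreover have "?e \<in> words A (m + 1)"
    using asm ne last_in_set[of y] by (auto simp: words_def)
  ultimately show "(x, y) \<in> arcs_ends (de_bruijn A m)"
    by (force simp: arcs_ends_conv de_bruijn_def image_iff intro: bexI[of _ ?e])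
qed

text \<open>A path is given by its start vertex together with its list of arcs; the start vertex
  is needed only to tell apart the paths of length 0.\<close>

definition paths_of_length :: "('a, 'b) pre_digraph \<Rightarrow> nat \<Rightarrow> ('a \<times> 'b awalk) set" where
  "paths_of_length G l = {(u, p). (\<exists>v. pre_digraph.apath G u p v) \<and> length p = l}"

end

theory Submission
  imports Defs "Graph_Theory.Euler"
begin

text \<open>A word of length \<open>N\<close> has at most \<open>min (q ^ n) (N - n + 1)\<close> factors of length \<open>n\<close>, and in the
  given range of \<open>N\<close> this is at most \<open>N - k\<close>, with equality only for \<open>n = k + 1\<close>, or for \<open>n = k\<close>
  and \<open>N = q ^ k + k\<close>. In the latter case all but one of the occurrences of \<open>k\<close>-factors are
  distinct, whereas a repeated \<open>(k + 1)\<close>-factor would cost two of them. Hence a complexity of \<open>N - k\<close>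
  always means that the \<open>(k + 1)\<close>-factors of the word are pairwise distinct, i.e. that the word
  spells a path in \<open>B(q, k + 1)\<close>. Such words exist because an Euler tour of \<open>B(q, k)\<close> spells a
  Hamiltonian path of \<open>B(q, k + 1)\<close>.\<close>

section \<open>Factors as lists of windows\<close>

text \<open>A list with one entry per starting position, so that a repeated factor shows up as a
  failure of \<open>distinct\<close>. Truncated subtraction makes it empty for
  \<open>n > length w\<close>.\<close>

definition windows :: "nat \<Rightarrow> 'a list \<Rightarrow> 'a list list" where
  "windows n w = map (\<lambda>i. take n (drop i w)) [0..<length w + 1 - n]"

lemma length_windows [simp]: "length (windows n w) = length w + 1 - n"
  by (simp add: windows_def)

lemma windows_nth: "i < length w + 1 - n \<Longrightarrow> windows n w ! i = take n (drop i w)"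
  by (simp add: windows_def)

lemma windows_eq_Nil [simp]: "length w < n \<Longrightarrow> windows n w = []"
  by (simp add: windows_def)

lemma windows_eq_single [simp]: "length w = n \<Longrightarrow> windows n w = [w]"
  by (auto simp: windows_def)

lemma windows_Cons:
  assumes "n \<le> length (x # w)"
  shows "windows n (x # w) = take n (x # w) # windows n w"
proof -
  have "[0..<length (x # w) + 1 - n] = 0 # map Suc [0..<length w + 1 - n]"
    using assms by (simp add: map_Suc_upt upt_conv_Cons Suc_diff_le del: upt_Suc)
  then show ?thesis
    by (simp add: windows_def comp_def)
qed

lemma factors_eq_set_windows: "factors n w = set (windows n w)"
proof (intro set_eqI iffI)
  fix u assume "u \<in> factors n w"
  then obtain x y where "length u = n" "w = x @ u @ y"
    by (auto simp: factors_def sublist_def)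
  then show "u \<in> set (windows n w)"
    by (auto simp: windows_def image_iff intro!: bexI[of _ "length x"])
next
  fix u assume "u \<in> set (windows n w)"
  then obtain i where "i < length w + 1 - n" "u = take n (drop i w)"
    by (auto simp: windows_def)
  then show "u \<in> factors n w"
    by (auto simp: factors_def sublist_order.order.trans[OF sublist_take sublist_drop])
qed

lemma subword_complexity_windows: "subword_complexity w n = card (set (windows n w))"
  by (simp add: subword_complexity_def factors_eq_set_windows)

lemma windows_in_words: "w \<in> words A N \<Longrightarrow> set (windows n w) \<subseteq> words A n"
  by (auto simp: words_def windows_def dest!: in_set_takeD in_set_dropD)

lemma finite_words: "finite A \<Longrightarrow> finite (words A n)"
  by (simp add: words_def finite_lists_length_eq)

lemma card_words: "finite A \<Longrightarrow> card (words A n) = card A ^ n"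
  by (simp add: words_def card_lists_length_eq)

text \<open>The windows of a prefix form an initial segment of the windows of the whole word. This
  later cuts a de Bruijn word down to length \<open>N\<close>.\<close>

lemma distinct_windows_take:
  assumes "distinct (windows n w)" "n \<le> m" "m \<le> length w"
  shows "distinct (windows n (take m w))"
proof -
  have "windows n (take m w) = take (m + 1 - n) (windows n w)"
  proof (rule nth_equalityI)
    fix i assume "i < length (windows n (take m w))"
    with assms(2,3) have "i + n \<le> m"
      by auto
    then show "windows n (take m w) ! i = take (m + 1 - n) (windows n w) ! i"
      using assms(3) by (simp add: windows_nth take_drop)
  qed (use assms in simp)
  with assms(1) show ?thesis
    by simp
qed

text \<open>A factor of length \<open>n + 1\<close> recurring at \<open>i < j\<close> makes its
  prefix and its suffix of length \<open>n\<close> recur at \<open>j\<close> and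
  \<open>j + 1\<close>, so at least two windows of length \<open>n\<close> are redundant.\<close>

lemma distinct_windows_Suc:
  assumes "length (windows n w) \<le> card (set (windows n w)) + 1"
  shows "distinct (windows (Suc n) w)"
proof (rule ccontr)
  let ?L = "length w + 1 - n" and ?v = "\<lambda>i. take n (drop i w)"
  assume "\<not> distinct (windows (Suc n) w)"
  then obtain i j where "i \<noteq> j" "i < length w - n" "j < length w - n"
    "windows (Suc n) w ! i = windows (Suc n) w ! j"
    by (auto simp: distinct_conv_nth)
  then obtain i j where ij: "i < j" "j < length w - n"
    "windows (Suc n) w ! i = windows (Suc n) w ! j"
    by (metis linorder_neqE_nat)
  then have eq: "take (Suc n) (drop i w) = take (Suc n) (drop j w)"
    by (simp add: windows_nth)
  from arg_cong[OF eq, of "take n"] have eq0: "?v i = ?v j"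
    by (simp add: min_def)
  from arg_cong[OF eq, of tl] have eq1: "?v (Suc i) = ?v (Suc j)"
    using ij by (simp add: drop_Suc tl_drop tl_take)
  have "set (windows n w) \<subseteq> ?v ` ({..<?L} - {j, Suc j})"
  proof
    fix u assume "u \<in> set (windows n w)"
    then obtain l where l: "l < ?L" "u = ?v l"
      by (auto simp: windows_def)
    \<comment> \<open>The windows at \<open>j\<close> and \<open>Suc j\<close> have copies at
      \<open>i\<close> and \<open>Suc i\<close>. If \<open>Suc i = j\<close>, the second copy sits
      at an excluded position, but it in turn equals the window at \<open>i\<close>.\<close>
    consider "l \<noteq> j" "l \<noteq> Suc j" | "l = j \<or> l = Suc j \<and> Suc i = j" | "l = Suc j" "Suc i \<noteq> j"
      by blast
    then show "u \<in> ?v ` ({..<?L} - {j, Suc j})"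
    proof cases
      case 1
      then show ?thesis using l by blast
    next
      case 2
      then have "u = ?v i" using l eq0 eq1 by auto
      then show ?thesis using ij by auto
    next
      case 3
      then have "u = ?v (Suc i)" using l eq1 by auto
      then show ?thesis using 3 ij by auto
    qed
  qed
  then have "card (set (windows n w)) \<le> card ({..<?L} - {j, Suc j})"
    by (meson surj_card_le finite_Diff finite_lessThan)
  also have "\<dots> = ?L - 2"
    using ij by (subst card_Diff_subset) auto
  finally show False
    using assms ij by simp
qed

section \<open>Words and walks in de Bruijn graphs\<close>

text \<open>The correspondence between the walks of \<open>de_bruijn A m\<close> and the words over \<open>A\<close> of length at
  least \<open>m\<close>: a word \<open>w\<close> spells the walk from \<open>take m w\<close> along the arcs \<open>windows (Suc m) w\<close>, and
  the walk \<open>(u, p)\<close> spells \<open>u @ map last p\<close>.\<close>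

lemma de_bruijn_simps [simp]:
  "verts (de_bruijn A m) = words A m" "arcs (de_bruijn A m) = words A (Suc m)"
  "tail (de_bruijn A m) = butlast" "head (de_bruijn A m) = tl"
  by (simp_all add: de_bruijn_def)

lemma butlast_take_Cons: "m \<le> length w \<Longrightarrow> butlast (x # take m w) = take m (x # w)"
  using butlast_take[of "Suc m" "x # w"] by simp

text \<open>Makes distinctness of the vertices of a walk the same condition as
  \<open>distinct (windows m w)\<close>. Prepending a letter to a word of length at least
  \<open>m\<close> prepends one arc and one vertex.\<close>

lemma awalk_verts_windows:
  assumes "m \<le> length w"
  shows "pre_digraph.awalk_verts (de_bruijn A m) (take m w) (windows (Suc m) w) = windows m w"
  using assms
proof (induction w)
  case Nil
  then show ?case by (simp add: pre_digraph.awalk_verts.simps)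
next
  case (Cons x w)
  show ?case
  proof (cases "m = length (x # w)")
    case True
    then show ?thesis
      by (simp add: pre_digraph.awalk_verts.simps)
  next
    case False
    with Cons show ?thesis
      by (simp add: windows_Cons pre_digraph.awalk_verts.simps butlast_take_Cons del: butlast.simps)
  qed
qed

lemma awalk_windows:
  assumes "m \<le> length w" "set w \<subseteq> A"
  shows "pre_digraph.awalk (de_bruijn A m) (take m w) (windows (Suc m) w) (drop (length w - m) w)"
proof -
  have "w \<in> words A (length w)"
    using assms by (simp add: words_def)
  then have "set (windows (Suc m) w) \<subseteq> words A (Suc m)"
    by (rule windows_in_words)
  moreover have "take m w \<in> words A m"
    using assms by (auto simp: words_def dest: in_set_takeD)
  moreover have "pre_digraph.cas (de_bruijn A m) (take m w) (windows (Suc m) w)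
      (drop (length w - m) w)"
    using assms(1)
  proof (induction w)
    case Nil
    then show ?case by (simp add: pre_digraph.cas.simps)
  next
    case (Cons x w)
    show ?case
    proof (cases "m = length (x # w)")
      case True
      then show ?thesis
        by (simp add: pre_digraph.cas.simps)
    next
      case False
      with Cons show ?thesis
        by (simp add: windows_Cons pre_digraph.cas.simps butlast_take_Cons Suc_diff_le
            del: butlast.simps)
    qed
  qed
  ultimately show ?thesis
    by (simp add: pre_digraph.awalk_def)
qed

lemma word_of_windows:
  "m \<le> length w \<Longrightarrow> take m w @ map last (windows (Suc m) w) = w"
proof (induction w)
  case (Cons x w)
  show ?case
  proof (cases "m = length (x # w)")
    case False
    then have m: "m \<le> length w" using Cons.prems by simp
    \<comment> \<open>The start vertex followed by the last letter of the first arc is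
      \<open>x\<close> followed by the start vertex for \<open>w\<close>, which exposes the
      induction hypothesis.\<close>
    then have "take m (x # w) @ [last (x # take m w)] = x # take m w"
      by (metis append_butlast_last_id butlast_take_Cons list.distinct(1))
    then have "take m (x # w) @ map last (windows (Suc m) (x # w)) =
        (x # take m w) @ map last (windows (Suc m) w)"
      using m by (simp add: windows_Cons del: last.simps append_Cons)
    with Cons.IH[OF m] show ?thesis
      by simp
  qed simp
qed simp

lemma windows_of_awalk:
  assumes "pre_digraph.awalk (de_bruijn A m) u p v"
  defines "w \<equiv> u @ map last p"
  shows "w \<in> words A (m + length p)" "take m w = u" "windows (Suc m) w = p"
proof -
  have "w \<in> words A (m + length p) \<and> windows (Suc m) w = p"
    using assms(1) unfolding w_def
  proof (induction p arbitrary: u)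
    case Nil
    then show ?case
      by (simp add: pre_digraph.awalk_def words_def)
  next
    case (Cons e p)
    then have e: "set e \<subseteq> A" "length e = Suc m" "butlast e = u"
      by (simp_all add: pre_digraph.awalk_def pre_digraph.cas.simps words_def)
    then have "tl e \<in> words A m"
      by (cases e) (simp_all add: words_def)
    with Cons.prems have p: "pre_digraph.awalk (de_bruijn A m) (tl e) p v"
      by (simp add: pre_digraph.awalk_def pre_digraph.cas.simps)
    \<comment> \<open>Since \<open>butlast e = u\<close>, the start vertex and \<open>last e\<close>
      join to \<open>e\<close>. Behind the first letter of \<open>e\<close> stands the word spelled
      by the remaining walk from \<open>tl e\<close>, and \<open>e\<close> is the one window added
      in front.\<close>
    have "u @ map last (e # p) = e @ map last p"
      using e by (cases e rule: rev_cases) auto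
    also have "\<dots> = hd e # (tl e @ map last p)"
      using e by (cases e) auto
    finally have w: "u @ map last (e # p) = hd e # (tl e @ map last p)" .
    have "take (Suc m) (hd e # (tl e @ map last p)) = e"
      using e by (cases e) auto
    moreover have "hd e \<in> A"
      using e by (cases e) auto
    ultimately show ?case
      using Cons.IH[OF p] e unfolding w
      by (auto simp: windows_Cons words_def)
  qed
  then show "w \<in> words A (m + length p)" "windows (Suc m) w = p"
    by auto
  show "take m w = u"
    using assms by (simp add: pre_digraph.awalk_def words_def)
qed

text \<open>Spelling a walk and reading off windows are mutually inverse, and the windows of length
  \<open>m\<close> are the vertices visited.\<close>

lemma card_paths_de_bruijn:
  "card (paths_of_length (de_bruijn A m) l) = card {w \<in> words A (m + l). distinct (windows m w)}"
    (is "card ?P = card ?W")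
proof -
  have "bij_betw (\<lambda>(u, p). u @ map last p) ?P ?W"
  proof (rule bij_betw_byWitness[where f' = "\<lambda>w. (take m w, windows (Suc m) w)"])
    show "\<forall>a\<in>?P. (\<lambda>w. (take m w, windows (Suc m) w)) ((\<lambda>(u, p). u @ map last p) a) = a"
      by (clarsimp simp: paths_of_length_def pre_digraph.apath_def windows_of_awalk
          simp del: take_append)
    show "\<forall>w\<in>?W. (\<lambda>(u, p). u @ map last p) (take m w, windows (Suc m) w) = w"
      by (simp add: words_def word_of_windows)
    show "(\<lambda>(u, p). u @ map last p) ` ?P \<subseteq> ?W"
    proof (clarsimp simp: paths_of_length_def)
      fix u p v assume p: "pre_digraph.apath (de_bruijn A m) u p v"
      then have aw: "pre_digraph.awalk (de_bruijn A m) u p v"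
        by (simp add: pre_digraph.apath_def)
      note w = windows_of_awalk[OF aw]
      have "windows m (u @ map last p) = pre_digraph.awalk_verts (de_bruijn A m) u p"
        using awalk_verts_windows[of m "u @ map last p" A] w by (auto simp: words_def)
      with w(1) p show "u @ map last p \<in> words A (m + length p) \<and>
          distinct (windows m (u @ map last p))"
        by (simp add: pre_digraph.apath_def)
    qed
    show "(\<lambda>w. (take m w, windows (Suc m) w)) ` ?W \<subseteq> ?P"
    proof (rule image_subsetI)
      fix w assume "w \<in> ?W"
      then have w: "m \<le> length w" "length w = m + l" "set w \<subseteq> A" "distinct (windows m w)"
        by (auto simp: words_def)
      with awalk_windows[OF w(1,3)] awalk_verts_windows[OF w(1), of A]
      show "(take m w, windows (Suc m) w) \<in> ?P"
        by (auto simp: paths_of_length_def pre_digraph.apath_def)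
    qed
  qed
  then show ?thesis
    by (rule bij_betw_same_card)
qed

section \<open>Euler trails and de Bruijn words\<close>

lemma connected_de_bruijn:
  assumes "A \<noteq> {}"
  shows "connected (de_bruijn A m)"
proof -
  interpret wf_digraph "de_bruijn A m" by (rule wf_digraph_de_bruijn)
  show ?thesis
  proof (rule connectedI)
    from assms obtain a where "a \<in> A" by blast
    then have "replicate m a \<in> verts (de_bruijn A m)"
      by (auto simp: words_def)
    then show "verts (de_bruijn A m) \<noteq> {}" by blast
  next
    fix u v assume "u \<in> verts (de_bruijn A m)" "v \<in> verts (de_bruijn A m)"
    \<comment> \<open>The word \<open>u @ v\<close> spells a walk of \<open>m\<close> arcs from
      \<open>u\<close> to \<open>v\<close>.\<close>
    then have "awalk u (windows (Suc m) (u @ v)) v"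
      using awalk_windows[of m "u @ v" A] by (simp add: words_def)
    then have "u \<rightarrow>\<^sup>*\<^bsub>de_bruijn A m\<^esub> v"
      unfolding reachable_awalk by blast
    then show "u \<rightarrow>\<^sup>*\<^bsub>with_proj (mk_symmetric (de_bruijn A m))\<^esub> v"
      by (rule reachable_mk_symmetricI)
  qed
qed

text \<open>Supplies the balance of in- and out-degrees for Euler's theorem: arcs into
  \<open>u\<close> prepend a letter, arcs out of \<open>u\<close> append one.\<close>

lemma degree_de_bruijn:
  assumes "u \<in> words A m"
  shows "in_degree (de_bruijn A m) u = card A" "out_degree (de_bruijn A m) u = card A"
proof -
  have "in_arcs (de_bruijn A m) u = (\<lambda>a. a # u) ` A"
  proof (intro set_eqI iffI)
    fix e assume "e \<in> in_arcs (de_bruijn A m) u"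
    then show "e \<in> (\<lambda>a. a # u) ` A"
      by (cases e) (auto simp: words_def)
  qed (use assms in \<open>auto simp: words_def\<close>)
  then show "in_degree (de_bruijn A m) u = card A"
    by (simp add: in_degree_def card_image inj_on_def)
  have "out_arcs (de_bruijn A m) u = (\<lambda>a. u @ [a]) ` A"
  proof (intro set_eqI iffI)
    fix e assume "e \<in> out_arcs (de_bruijn A m) u"
    then show "e \<in> (\<lambda>a. u @ [a]) ` A"
      by (cases e rule: rev_cases) (auto simp: words_def)
  qed (use assms in \<open>auto simp: words_def\<close>)
  then show "out_degree (de_bruijn A m) u = card A"
    by (simp add: out_degree_def card_image inj_on_def)
qed

text \<open>A closed Euler trail has each word of length \<open>Suc m\<close> as an arc exactly
  once; these arcs are the windows of the word it spells.\<close>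

lemma de_bruijn_sequence_exists:
  assumes "finite A" "A \<noteq> {}"
  shows "\<exists>w \<in> words A (m + card A ^ Suc m). distinct (windows (Suc m) w)"
proof -
  interpret wf_digraph "de_bruijn A m" by (rule wf_digraph_de_bruijn)
  interpret fin_digraph "de_bruijn A m"
    by unfold_locales (simp_all add: finite_words assms)
  obtain u p where "euler_trail u p u"
    using closed_euler1[OF connected_de_bruijn[OF assms(2)]] degree_de_bruijn by fastforce
  then have p: "awalk u p u" "distinct p" "set p = words A (Suc m)"
    by (auto simp: euler_trail_def trail_def)
  then have "length p = card A ^ Suc m"
    using card_words[OF assms(1), of "Suc m"] distinct_card[of p] by simp
  with windows_of_awalk[OF p(1)] p(2) show ?thesis
    by (metis (full_types))
qed

section \<open>Words of maximal complexity\<close>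

theorem proposition3:
  fixes A :: "'a set" and q k N :: nat
  assumes "finite A" and "card A = q" and "q \<ge> 2" and "k \<ge> 1"
    and "q ^ k + k \<le> N" and "N \<le> q ^ (k + 1) + k"
  shows "num_max_words A N = card (paths_of_length (de_bruijn A (k + 1)) (N - k - 1))"
proof -
  have "q ^ k > 0"
    using assms(3) by simp
  \<comment> \<open>Ensures that the subtractions in \<open>N - k - 1\<close> are not truncated and
    that \<open>N - k\<close> is positive.\<close>
  then have N: "k + 1 \<le> N"
    using assms(5) by linarith
  \<comment> \<open>Two bounds, by the number of available words and by the number of positions; the
    first serves for \<open>n \<le> k\<close>, the second for \<open>n > k\<close>.\<close>
  have card_le: "subword_complexity w n \<le> q ^ n" if "w \<in> words A N" for w n
    unfolding subword_complexity_windows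
    using card_mono[OF finite_words[OF assms(1)] windows_in_words[OF that], of n]
      card_words[OF assms(1), of n] assms(2) by simp
  have length_le: "subword_complexity w n \<le> N + 1 - n" if "w \<in> words A N" for w n
    unfolding subword_complexity_windows
    using card_length[of "windows n w"] that by (simp add: words_def)
  have le: "subword_complexity w n \<le> N - k" if "w \<in> words A N" for w n
  proof (cases "n \<le> k")
    case True
    then have "q ^ n \<le> q ^ k"
      using assms(3) by (simp add: power_increasing)
    then show ?thesis
      using card_le[OF that, of n] assms(5) by linarith
  next
    case False
    then show ?thesis
      using length_le[OF that, of n] by linarith
  qed
  have max_le: "max_complexity w \<le> N - k" if "w \<in> words A N" for w
    unfolding max_complexity_def
    by (rule Max.boundedI[OF finite_subword_complexity_values]) (use le[OF that] in auto)
  have max_eq_iff: "max_complexity w = N - k \<longleftrightarrow> distinct (windows (k + 1) w)"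
    if w: "w \<in> words A N" for w
  proof
    assume "distinct (windows (k + 1) w)"
    then have "subword_complexity w (k + 1) = N - k"
      using w by (simp add: subword_complexity_windows distinct_card words_def)
    moreover have "subword_complexity w (k + 1) \<le> max_complexity w"
      unfolding max_complexity_def by (rule Max_ge[OF finite_subword_complexity_values]) simp
    ultimately show "max_complexity w = N - k"
      using max_le[OF w] by simp
  next
    assume "max_complexity w = N - k"
    moreover have "max_complexity w \<in> subword_complexity w ` {1..}"
      unfolding max_complexity_def by (rule Max_in[OF finite_subword_complexity_values]) auto
    ultimately obtain n where n: "subword_complexity w n = N - k"
      by auto
    \<comment> \<open>Any other length stays strictly below \<open>N - k\<close>: beyond
      \<open>k + 1\<close> there are too few positions, below \<open>k\<close> too few
      words.\<close>
    have "n \<le> k + 1"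
      using length_le[OF w, of n] n N by linarith
    moreover have "n \<ge> k"
    proof (rule ccontr)
      assume "\<not> n \<ge> k"
      then have "q ^ n < q ^ k"
        using assms(3) by (simp add: power_strict_increasing)
      then show False
        using card_le[OF w, of n] n assms(5) by linarith
    qed
    ultimately consider "n = k" | "n = k + 1"
      by linarith
    then show "distinct (windows (k + 1) w)"
    proof cases
      \<comment> \<open>There are \<open>N - k + 1\<close> windows of length \<open>k\<close> and
        \<open>N - k\<close> distinct ones, just the single repetition that
        \<open>distinct_windows_Suc\<close> tolerates.\<close>
      case 1
      then show ?thesis
        using n w N distinct_windows_Suc[of k w]
        by (simp add: subword_complexity_windows words_def)
    next
      case 2
      then show ?thesis
        using n w by (intro card_distinct) (simp add: subword_complexity_windows words_def)
    qed
  qed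
  have "A \<noteq> {}"
    using assms(2,3) by auto
  \<comment> \<open>A word of the greatest admissible length \<open>q ^ (k + 1) + k\<close>; its
    prefix of length \<open>N\<close> attains the bound \<open>N - k\<close>.\<close>
  then obtain w where w: "w \<in> words A (k + q ^ Suc k)" "distinct (windows (Suc k) w)"
    using de_bruijn_sequence_exists[OF assms(1), of k] assms(2) by auto
  have tw: "take N w \<in> words A N"
    using w(1) assms(6) by (auto simp: words_def dest: in_set_takeD)
  have "distinct (windows (k + 1) (take N w))"
    using w assms(6) N by (simp add: distinct_windows_take words_def)
  with tw have "N - k \<in> max_complexity ` words A N"
    using max_eq_iff by force
  then have "global_max_complexity A N = N - k"
    unfolding global_max_complexity_def
    using max_le by (intro Max_eqI) (auto simp: finite_words assms(1))
  then have "num_max_words A N = card {w \<in> words A N. distinct (windows (k + 1) w)}"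
    unfolding num_max_words_def using max_eq_iff by (metis (no_types, lifting))
  \<comment> \<open>Here \<open>m = k + 1\<close> and \<open>l = N - k - 1\<close>, so that
    \<open>m + l = N\<close>.\<close>
  also have "\<dots> = card (paths_of_length (de_bruijn A (k + 1)) (N - k - 1))"
    using N by (simp add: card_paths_de_bruijn)
  finally show ?thesis .
qed

end
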